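(* Let $V$ be a finite-dimensional real Euclidean vector space, let $R$ be a reduced root system in $V$ (not assumed irreducible, and not assumed to span $V$), and let $W\subset O(V)$ be its Weyl group. Let $a\in V$ be a minuscule element, and let $W_a=\{w\in W: w(a)=a\}$ be the stabilizer of $a$ in $W$. Then for every pair $(b,b')$ of elements of $V$ such that $b$ and $b'$ are $W$-conjugate and $a+b$ and $a+b'$ are also $W$-conjugate, the elements $b$ and $b'$ are conjugate under $W_a$; that is, there exists $w\in W_a$ with $w(b)=b'$.
   Context: $V$ carries a $W$-invariant scalar product $(-,-)$, and $W\subset O(V)$ is the finite group generated by the orthogonal reflections $s_\alpha$ for $\alpha\in R$. If $R$ does not span $V$, then $R$ is a root system in its span and $W$ acts trivially on the orthogonal complement of that span. Two elements $x,y\in V$ are $W$-conjugate if $y=w(x)$ for some $w\in W$. An element $a\in V$ is called minuscule (with respect to $R$) if for every irreducible component $R_i$ of $R$, the set of real numbers $\{(\alpha,a):\alpha\in R_i\}$ has at most $3$ elements. *)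

theory Defs
  imports "HOL-Analysis.Analysis"
begin

definition reflection :: "'a::euclidean_space \<Rightarrow> 'a \<Rightarrow> 'a" where
  "reflection \<alpha> x = x - (2 * (\<alpha> \<bullet> x) / (\<alpha> \<bullet> \<alpha>)) *\<^sub>R \<alpha>"

text \<open>Root systems in the sense of Bourbaki (crystallographic), except that the roots need not
  span the space, with the reflections taken orthogonal for the given scalar product.\<close>

definition root_system :: "'a::euclidean_space set \<Rightarrow> bool" where
  "root_system R \<longleftrightarrow>
     finite R \<and> 0 \<notin> R \<and>
     (\<forall>\<alpha>\<in>R. reflection \<alpha> ` R = R) \<and>
     (\<forall>\<alpha>\<in>R. \<forall>\<beta>\<in>R. 2 * (\<alpha> \<bullet> \<beta>) / (\<alpha> \<bullet> \<alpha>) \<in> \<int>)"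

definition reduced_root_system :: "'a::euclidean_space set \<Rightarrow> bool" where
  "reduced_root_system R \<longleftrightarrow>
     root_system R \<and> (\<forall>\<alpha>\<in>R. \<forall>c::real. c *\<^sub>R \<alpha> \<in> R \<longrightarrow> c = 1 \<or> c = - 1)"

text \<open>The group generated by the reflections in the roots. Reflections in nonzero vectors are
  involutions, so no rule for inverses is needed (see \<open>weyl_group_inv\<close> below).\<close>

inductive_set weyl_group :: "'a::euclidean_space set \<Rightarrow> ('a \<Rightarrow> 'a) set" for R where
  id: "id \<in> weyl_group R"
| refl: "\<alpha> \<in> R \<Longrightarrow> reflection \<alpha> \<in> weyl_group R"
| comp: "v \<in> weyl_group R \<Longrightarrow> w \<in> weyl_group R \<Longrightarrow> v \<circ> w \<in> weyl_group R"

definition stabilizer :: "('a \<Rightarrow> 'a) set \<Rightarrow> 'a \<Rightarrow> ('a \<Rightarrow> 'a) set" where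
  "stabilizer G a = {w \<in> G. w a = a}"

definition conjugate_under :: "('a \<Rightarrow> 'a) set \<Rightarrow> 'a \<Rightarrow> 'a \<Rightarrow> bool" where
  "conjugate_under G x y \<longleftrightarrow> (\<exists>w\<in>G. y = w x)"

definition irreducible_roots :: "'a::euclidean_space set \<Rightarrow> bool" where
  "irreducible_roots S \<longleftrightarrow>
     S \<noteq> {} \<and>
     \<not> (\<exists>A B. A \<noteq> {} \<and> B \<noteq> {} \<and> A \<union> B = S \<and> A \<inter> B = {} \<and>
            (\<forall>\<alpha>\<in>A. \<forall>\<beta>\<in>B. \<alpha> \<bullet> \<beta> = 0))"

definition irreducible_component :: "'a::euclidean_space set \<Rightarrow> 'a set \<Rightarrow> bool" where
  "irreducible_component R S \<longleftrightarrow>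
     S \<subseteq> R \<and> irreducible_roots S \<and> (\<forall>\<alpha>\<in>S. \<forall>\<beta>\<in>R - S. \<alpha> \<bullet> \<beta> = 0)"

text \<open>Finiteness is automatic for root systems; it is stated because \<open>card\<close> is 0 on infinite
  sets.\<close>

definition minuscule :: "'a::euclidean_space set \<Rightarrow> 'a \<Rightarrow> bool" where
  "minuscule R a \<longleftrightarrow>
     (\<forall>S. irreducible_component R S \<longrightarrow>
        finite {\<alpha> \<bullet> a | \<alpha>. \<alpha> \<in> S} \<and> card {\<alpha> \<bullet> a | \<alpha>. \<alpha> \<in> S} \<le> 3)"

lemma reflection_involution: "reflection \<alpha> (reflection \<alpha> x) = x"
  by (cases "\<alpha> = 0") (simp_all add: reflection_def inner_diff_right algebra_simps)

lemma orthogonal_transformation_reflection: "orthogonal_transformation (reflection \<alpha>)"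
proof -
  have "linear (reflection \<alpha>)"
    by (rule linearI)
      (simp_all add: reflection_def inner_add_right algebra_simps add_divide_distrib)
  moreover have "reflection \<alpha> x \<bullet> reflection \<alpha> y = x \<bullet> y" for x y
    by (cases "\<alpha> = 0")
      (simp_all add: reflection_def inner_diff_left inner_diff_right inner_commute field_simps)
  ultimately show ?thesis
    by (simp add: orthogonal_transformation_def)
qed

lemma weyl_group_orthogonal: "w \<in> weyl_group R \<Longrightarrow> orthogonal_transformation w"
proof (induction rule: weyl_group.induct)
  case id
  show ?case by (simp add: orthogonal_transformation_def linear_id)
next
  case (refl \<alpha>)
  show ?case by (rule orthogonal_transformation_reflection)
next
  case (comp v w)
  then show ?case by (auto intro: orthogonal_transformation_compose[unfolded o_def] simp: o_def)
qed

lemma weyl_group_inv: "w \<in> weyl_group R \<Longrightarrow> inv w \<in> weyl_group R"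
proof (induction rule: weyl_group.induct)
  case id
  show ?case using weyl_group.id[of R] by (simp add: id_def)
next
  case (refl \<alpha>)
  have "inv (reflection \<alpha>) = reflection \<alpha>"
    by (rule inv_equality) (simp_all add: reflection_involution)
  with refl show ?case by (simp add: weyl_group.refl)
next
  case (comp v w)
  then have "bij v" "bij w"
    by (auto dest!: weyl_group_orthogonal orthogonal_transformation_bij)
  then have "inv (v \<circ> w) = inv w \<circ> inv v" by (simp add: o_inv_distrib)
  moreover have "inv w \<circ> inv v \<in> weyl_group R"
    using comp.IH(2,1) by (rule weyl_group.comp)
  ultimately show ?case by (simp only:)
qed

end

theory Submission
  imports Defs
begin

text \<open>Put \<open>a1 = a\<close> and \<open>a2 = inv w a\<close>, where \<open>b' = w b\<close>. Then \<open>v (b + a1) = b + a2\<close> for some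
  \<open>v \<in> W\<close>, and \<open>a1\<close> has to be conjugated to \<open>a2\<close> under the stabilizer of \<open>b\<close>. Let \<open>c \<alpha>\<close> be the
  maximum of \<open>\<bar>\<beta> \<bullet> a\<bar>\<close> over the irreducible component of \<open>\<alpha>\<close>. As \<open>a\<close> is minuscule, every
  \<open>\<alpha> \<bullet> u a\<close> with \<open>u \<in> W\<close> is one of \<open>- c \<alpha>\<close>, \<open>0\<close>, \<open>c \<alpha>\<close>; hence the map \<open>g x = v (x + a1) - a2\<close>,
  which fixes \<open>b\<close>, belongs to the group generated by the reflections in the affine hyperplanes
  \<open>\<alpha> \<bullet> x = k * c \<alpha>\<close> with \<open>k\<close> an integer. Move \<open>a1\<close> and \<open>a2\<close> to dominant position under the
  stabilizer of \<open>b\<close>, and change \<open>v\<close> by an element of the stabilizer of \<open>b + a2\<close>. Then some point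
  \<open>p\<close> near \<open>b\<close> lies on none of these hyperplanes, and none of them separates \<open>p\<close> from \<open>g p\<close>.
  This forces \<open>g = id\<close>, so \<open>a1 = a2\<close>.\<close>

section \<open>Signs of perturbed real numbers\<close>

lemma same_sign_trans:
  fixes x y z :: real
  shows "0 < x * y \<Longrightarrow> 0 < x * z \<Longrightarrow> 0 < y * z" "0 < x * y \<Longrightarrow> 0 \<le> x * z \<Longrightarrow> 0 \<le> y * z"
  by (auto simp: zero_less_mult_iff zero_le_mult_iff)

lemma abs_le_same_sign:
  fixes x y z :: real
  shows "\<bar>y\<bar> \<le> \<bar>x\<bar> \<Longrightarrow> 0 < x * z \<Longrightarrow> 0 \<le> (x + y) * z"
  by (auto simp: zero_less_mult_iff zero_le_mult_iff)

lemma abs_less_same_sign: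
  fixes x y z :: real
  shows "\<bar>y\<bar> < \<bar>x\<bar> \<Longrightarrow> \<bar>z\<bar> < \<bar>x\<bar> \<Longrightarrow> x + y \<noteq> 0 \<and> 0 \<le> (x + y) * (x + z)"
  by (auto simp: zero_le_mult_iff)

lemma abs_reflect_less:
  fixes x y :: real
  shows "\<bar>y\<bar> < \<bar>x\<bar> \<Longrightarrow> 0 < x * y \<Longrightarrow> \<bar>x - 2 * y\<bar> < \<bar>x\<bar>"
  by (auto simp: zero_less_mult_iff)

section \<open>Groups generated by affine reflections\<close>

text \<open>A pair \<open>(n, c)\<close> encodes the hyperplane \<open>n \<bullet> x = c\<close>.
  Proportional pairs encode the same one, so hyperplanes are compared through their
  reflections.\<close>

definition aff :: "'a::euclidean_space \<times> real \<Rightarrow> 'a \<Rightarrow> real" where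
  "aff h x = fst h \<bullet> x - snd h"

definition arefl :: "'a::euclidean_space \<times> real \<Rightarrow> 'a \<Rightarrow> 'a" where
  "arefl h x = x - (2 * aff h x / (fst h \<bullet> fst h)) *\<^sub>R fst h"

text \<open>The mirror image of the hyperplane \<open>h'\<close> under \<open>arefl h\<close>,
  scaled so that its affine function is exactly \<open>aff h' \<circ> arefl h\<close>.\<close>

definition pullback :: "'a::euclidean_space \<times> real \<Rightarrow> 'a \<times> real \<Rightarrow> 'a \<times> real" where
  "pullback h h' = (reflection (fst h) (fst h'),
     snd h' - 2 * snd h * (fst h \<bullet> fst h') / (fst h \<bullet> fst h))"

text \<open>The head acts last, so the values of successive prefixes at a point form a
  gallery.\<close>

definition word :: "('a::euclidean_space \<times> real) list \<Rightarrow> 'a \<Rightarrow> 'a" where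
  "word hs = foldr (\<lambda>h g. arefl h \<circ> g) hs id"

lemma word_Nil [simp]: "word [] = id"
  and word_Cons [simp]: "word (h # hs) = arefl h \<circ> word hs"
  by (simp_all add: word_def)

lemma word_append: "word (hs @ hs') = word hs \<circ> word hs'"
  by (induction hs) (simp_all add: o_assoc)

lemma aff_arefl:
  "aff h' (arefl h x) = aff h' x - 2 * aff h x * (fst h \<bullet> fst h') / (fst h \<bullet> fst h)"
  by (simp add: aff_def arefl_def inner_diff_right inner_commute)

lemma aff_arefl_self: "fst h \<noteq> 0 \<Longrightarrow> aff h (arefl h x) = - aff h x"
  by (simp add: aff_arefl)

lemma arefl_arefl [simp]: "arefl h (arefl h x) = x"
proof (cases "fst h = 0")
  case False
  then show ?thesis
    by (simp add: arefl_def [of h "arefl h x"] aff_arefl_self) (simp add: arefl_def)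
qed (simp add: arefl_def)

lemma aff_pullback: "aff (pullback h h') x = aff h' (arefl h x)"
  by (simp add: aff_arefl) (simp add: aff_def pullback_def reflection_def inner_diff_left
    inner_diff_right inner_commute algebra_simps diff_divide_distrib)

lemma inner_reflection: "reflection \<alpha> x \<bullet> reflection \<alpha> y = x \<bullet> y"
  using orthogonal_transformation_reflection [of \<alpha>]
  by (simp add: orthogonal_transformation_def)

lemma norm_fst_pullback: "norm (fst (pullback h h')) = norm (fst h')"
  by (simp add: pullback_def norm_eq_sqrt_inner inner_reflection)

lemma arefl_diff: "arefl h (x - z) = arefl h x - reflection (fst h) z"
  by (simp add: arefl_def reflection_def aff_def inner_diff_right algebra_simps diff_divide_distrib
      add_divide_distrib)

lemma reflection_scaleR: "reflection \<alpha> (t *\<^sub>R x) = t *\<^sub>R reflection \<alpha> x"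
  by (simp add: reflection_def algebra_simps)

lemma arefl_pullback: "arefl (pullback h h') x = arefl h (arefl h' (arefl h x))"
proof -
  have n: "fst (pullback h h') \<bullet> fst (pullback h h') = fst h' \<bullet> fst h'"
    by (simp add: pullback_def inner_reflection)
  have "arefl h (arefl h' (arefl h x)) =
    arefl h (arefl h x - (2 * aff h' (arefl h x) / (fst h' \<bullet> fst h')) *\<^sub>R fst h')"
    by (simp only: arefl_def [of h'])
  also have "\<dots> = x - (2 * aff h' (arefl h x) / (fst h' \<bullet> fst h')) *\<^sub>R reflection (fst h) (fst h')"
    by (simp add: arefl_diff reflection_scaleR)
  also have "\<dots> = arefl (pullback h h') x"
    by (simp add: arefl_def [of "pullback h h'"] n aff_pullback) (simp add: pullback_def)
  finally show ?thesis by simp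
qed

lemma arefl_eqI:
  assumes "\<mu> \<noteq> 0" "fst q = \<mu> *\<^sub>R fst h" "\<And>x. aff q x = \<mu> * aff h x"
  shows "arefl q = arefl h"
  using assms by (auto simp: arefl_def fun_eq_iff)

section \<open>Chambers of a locally finite hyperplane arrangement\<close>

locale reflection_arrangement =
  fixes H :: "('a::euclidean_space \<times> real) set" and p :: 'a
  assumes normal_nonzero: "h \<in> H \<Longrightarrow> fst h \<noteq> 0"
    and pullback_closed: "h \<in> H \<Longrightarrow> h' \<in> H \<Longrightarrow> pullback h h' \<in> H"
    and regular: "h \<in> H \<Longrightarrow> aff h p \<noteq> 0"
    and locally_finite: "finite {h \<in> H. \<bar>aff h p\<bar> \<le> K * norm (fst h)}"
begin

text \<open>These are the walls of the chamber of \<open>p\<close>: no other hyperplane lies between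
  \<open>p\<close> and its mirror image.\<close>

definition simple :: "('a \<times> real) set" where
  "simple = {h \<in> H. \<forall>q\<in>H. aff q p * aff q (arefl h p) < 0 \<longrightarrow> arefl q = arefl h}"

definition height :: "'a \<times> real \<Rightarrow> real" where
  "height h = \<bar>aff h p\<bar> / norm (fst h)"

text \<open>Heights are distances from \<open>p\<close>, hence real numbers, but local finiteness
  leaves only finitely many pairs below each height; the induction is on their number.\<close>

lemma height_less_induct [consumes 1, case_names less]:
  assumes "h \<in> H"
    and step: "\<And>h. h \<in> H \<Longrightarrow> (\<And>q. q \<in> H \<Longrightarrow> height q < height h \<Longrightarrow> P q) \<Longrightarrow> P h"
  shows "P h"
proof -
  define below where "below h = {q \<in> H. height q < height h}" for h
  have fin: "finite (below h)" for h
  proof (rule finite_subset)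
    show "below h \<subseteq> {q \<in> H. \<bar>aff q p\<bar> \<le> height h * norm (fst q)}"
    proof
      fix q assume q: "q \<in> below h"
      then have "0 < norm (fst q)" using normal_nonzero by (auto simp: below_def)
      with q show "q \<in> {q \<in> H. \<bar>aff q p\<bar> \<le> height h * norm (fst q)}"
        by (simp add: below_def height_def [of q] pos_divide_less_eq)
    qed
  qed (rule locally_finite)
  show ?thesis
    using \<open>h \<in> H\<close>
  proof (induction "card (below h)" arbitrary: h rule: less_induct)
    case less
    show ?case
    proof (rule step [OF less.prems])
      fix q assume q: "q \<in> H" "height q < height h"
      then have "below q \<subset> below h" by (auto simp: below_def)
      then have "card (below q) < card (below h)" by (rule psubset_card_mono [OF fin])
      then show "P q" using less.hyps q by blast
    qed
  qed
qed

text \<open>The sum \<open>aff q p + aff q (arefl h p)\<close> is twice the value of \<open>aff q\<close> at the midpoint of \<open>p\<close> and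
  \<open>arefl h p\<close>.\<close>

lemma height_decrease:
  assumes h: "h \<in> H" and q: "q \<in> H" and ne: "arefl q \<noteq> arefl h"
    and near: "aff q p * (aff q p + aff q (arefl h p)) \<le> 0"
  shows "height q < height h" "height (pullback q h) < height h"
proof -
  define n m where "n = fst h" and "m = fst q"
  define A B c where "A = aff h p" and "B = aff q p" and "c = n \<bullet> m"
  have n0: "n \<noteq> 0" "m \<noteq> 0" using normal_nonzero h q by (auto simp: n_def m_def)
  then have nn: "n \<bullet> n > 0" "m \<bullet> m > 0" by auto
  have img: "aff q (arefl h p) = B - 2 * A * c / (n \<bullet> n)"
    by (simp add: aff_arefl A_def B_def c_def n_def m_def)
  have nonzero: "A \<noteq> 0" "B \<noteq> 0" using regular h q by (auto simp: A_def B_def)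
  have "2 * (B * (B - A * c / (n \<bullet> n))) \<le> 0"
    using near by (simp add: img B_def [symmetric] algebra_simps)
  then have "B * (B - A * c / (n \<bullet> n)) \<le> 0" by simp
  then have near': "B * B * (n \<bullet> n) \<le> A * B * c"
    using nn by (simp add: field_simps)
  have "0 < B * B * (n \<bullet> n)" using nonzero(2) nn(1) by (metis mult_pos_pos not_real_square_gt_zero)
  then have ABc: "0 < A * B * c" using near' by linarith
  have "\<bar>B\<bar> * (\<bar>B\<bar> * (norm n)\<^sup>2) \<le> \<bar>B\<bar> * (\<bar>A\<bar> * \<bar>c\<bar>)"
    using near' ABc by (simp add: power2_norm_eq_inner abs_mult [symmetric] ac_simps)
  then have Bc: "\<bar>B\<bar> * (norm n)\<^sup>2 \<le> \<bar>A\<bar> * \<bar>c\<bar>"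
    using nonzero by simp
  have CS: "\<bar>c\<bar> \<le> norm n * norm m" unfolding c_def by (rule Cauchy_Schwarz_ineq2)
  have le: "\<bar>B\<bar> * norm n \<le> \<bar>A\<bar> * norm m"
  proof -
    have "\<bar>B\<bar> * (norm n)\<^sup>2 \<le> \<bar>A\<bar> * (norm n * norm m)"
      using Bc CS by (meson abs_ge_zero mult_left_mono order_trans)
    then have "norm n * (\<bar>B\<bar> * norm n) \<le> norm n * (\<bar>A\<bar> * norm m)"
      by (simp add: power2_eq_square ac_simps)
    then show ?thesis using n0 by simp
  qed
  \<comment> \<open>Equality would force equality in Cauchy-Schwarz, hence parallel normals. Equal
    distance from \<open>p\<close> and the sign of \<open>A * B * c\<close> then make the two
    hyperplanes coincide, against \<open>ne\<close>.\<close>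
  have strict: "\<bar>B\<bar> * norm n < \<bar>A\<bar> * norm m"
  proof (rule ccontr)
    assume "\<not> ?thesis"
    then have eq: "\<bar>B\<bar> * norm n = \<bar>A\<bar> * norm m" using le by simp
    have "\<bar>A\<bar> * (norm n * norm m) = \<bar>B\<bar> * (norm n)\<^sup>2"
      using eq by (simp add: power2_eq_square)
    then have "\<bar>A\<bar> * (norm n * norm m) \<le> \<bar>A\<bar> * \<bar>c\<bar>" using Bc by simp
    then have "\<bar>c\<bar> = norm n * norm m" using CS nonzero by simp
    then have par: "norm n *\<^sub>R m = norm m *\<^sub>R n \<or> norm n *\<^sub>R m = - norm m *\<^sub>R n"
      unfolding c_def norm_cauchy_schwarz_abs_eq by auto
    obtain \<mu> where mu: "m = \<mu> *\<^sub>R n"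
    proof -
      from par have "m = (norm m / norm n) *\<^sub>R n \<or> m = (- norm m / norm n) *\<^sub>R n"
      proof
        assume "norm n *\<^sub>R m = norm m *\<^sub>R n"
        then have "(1 / norm n) *\<^sub>R (norm n *\<^sub>R m) = (1 / norm n) *\<^sub>R (norm m *\<^sub>R n)" by simp
        then show ?thesis using n0 by simp
      next
        assume "norm n *\<^sub>R m = - norm m *\<^sub>R n"
        then have "(1 / norm n) *\<^sub>R (norm n *\<^sub>R m) = (1 / norm n) *\<^sub>R (- norm m *\<^sub>R n)" by simp
        then show ?thesis using n0 by simp
      qed
      then show ?thesis using that by blast
    qed
    have mu0: "\<mu> \<noteq> 0" using mu n0 by auto
    have "\<bar>B\<bar> = \<bar>\<mu> * A\<bar>" using eq n0 by (simp add: mu abs_mult)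
    moreover have "0 < B * (\<mu> * A)"
    proof -
      have "A * B * c = B * (\<mu> * A) * (n \<bullet> n)" by (simp add: c_def mu)
      then show ?thesis using ABc nn by (metis zero_less_mult_pos2)
    qed
    ultimately have BA: "B = \<mu> * A" by (auto simp: abs_if zero_less_mult_iff split: if_splits)
    have "aff q x = \<mu> * aff h x" for x
    proof -
      have "aff q x = B + m \<bullet> (x - p)"
        by (simp add: B_def aff_def m_def inner_diff_right)
      also have "\<dots> = \<mu> * (A + n \<bullet> (x - p))" by (simp add: BA mu algebra_simps)
      also have "A + n \<bullet> (x - p) = aff h x" by (simp add: A_def aff_def n_def inner_diff_right)
      finally show ?thesis .
    qed
    then have "arefl q = arefl h"
      using mu mu0 by (intro arefl_eqI [of \<mu>]) (simp_all add: n_def m_def)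
    with ne show False by contradiction
  qed
  then show "height q < height h"
    using n0 by (simp add: height_def A_def [symmetric] B_def [symmetric] n_def [symmetric]
      m_def [symmetric] field_simps)
  \<comment> \<open>The difference is \<open>aff (pullback q h) p\<close>; the quantity subtracted
    twice has the sign of \<open>A\<close> and smaller modulus.\<close>
  have "\<bar>A - 2 * (B * c / (m \<bullet> m))\<bar> < \<bar>A\<bar>"
  proof -
    have "\<bar>B * c / (m \<bullet> m)\<bar> < \<bar>A\<bar>"
    proof -
      have "\<bar>B\<bar> * \<bar>c\<bar> \<le> (\<bar>B\<bar> * norm n) * norm m"
        using CS by (simp add: mult_left_mono mult.assoc)
      also have "\<dots> < (\<bar>A\<bar> * norm m) * norm m" using strict n0 by simp
      also have "\<dots> = \<bar>A\<bar> * (m \<bullet> m)" by (simp add: dot_square_norm power2_eq_square)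
      finally show ?thesis using nn by (simp add: abs_mult pos_divide_less_eq)
    qed
    moreover have "0 < A * (B * c / (m \<bullet> m))" using ABc nn by (simp add: mult.assoc)
    ultimately show ?thesis by (rule abs_reflect_less)
  qed
  then have "\<bar>aff (pullback q h) p\<bar> < \<bar>aff h p\<bar>"
    by (simp add: aff_pullback aff_arefl A_def B_def c_def n_def m_def inner_commute mult.assoc)
  then show "height (pullback q h) < height h"
    using n0 by (simp add: height_def norm_fst_pullback n_def [symmetric] divide_strict_right_mono)
qed

text \<open>If a hyperplane other than that of \<open>h\<close> separates \<open>p\<close> from its mirror image, then
  it or its image under \<open>arefl h\<close> meets the half of the segment near \<open>p\<close>. Conjugating by the
  reflection in that hyperplane expresses \<open>arefl h\<close> by reflections in hyperplanes closer to \<open>p\<close>.\<close>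

lemma arefl_simple_word:
  assumes "h \<in> H"
  shows "\<exists>hs. set hs \<subseteq> simple \<and> arefl h = word hs"
  using assms
proof (induction h rule: height_less_induct)
  case (less h)
  show ?case
  proof (cases "h \<in> simple")
    case True
    then show ?thesis by (intro exI [of _ "[h]"]) simp
  next
    case False
    then obtain q0 where q0: "q0 \<in> H" "aff q0 p * aff q0 (arefl h p) < 0" "arefl q0 \<noteq> arefl h"
      using less.hyps by (auto simp: simple_def)
    define q1 where "q1 = pullback h q0"
    have q1: "q1 \<in> H" using pullback_closed less.hyps q0 by (simp add: q1_def)
    have val: "aff q1 p = aff q0 (arefl h p)" "aff q1 (arefl h p) = aff q0 p"
      by (simp_all add: q1_def aff_pullback)
    have ne1: "arefl q1 \<noteq> arefl h"
    proof
      assume "arefl q1 = arefl h"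
      then have "arefl h (arefl q1 (arefl h x)) = arefl h x" for x by simp
      then have "arefl q0 x = arefl h x" for x by (simp add: q1_def arefl_pullback)
      then show False using q0 by blast
    qed
    obtain q where q: "q \<in> H" "aff q p * aff q (arefl h p) < 0" "arefl q \<noteq> arefl h"
      "aff q p * (aff q p + aff q (arefl h p)) \<le> 0"
    proof (cases "aff q0 p * (aff q0 p + aff q0 (arefl h p)) \<le> 0")
      case True
      then show ?thesis using that q0 by blast
    next
      case False
      then have "aff q1 p * (aff q1 p + aff q1 (arefl h p)) \<le> 0"
        using q0(2) unfolding val
        by (auto simp: mult_less_0_iff mult_le_0_iff)
      then show ?thesis using that [of q1] q1 ne1 q0(2) val by (simp add: mult.commute)
    qed
    from height_decrease [OF less.hyps q(1,3,4)]
    obtain us vs where "set us \<subseteq> simple" "arefl q = word us"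
      "set vs \<subseteq> simple" "arefl (pullback q h) = word vs"
      using less.IH [of q] less.IH [of "pullback q h"] q(1) less.hyps pullback_closed by blast
    moreover have "arefl h = arefl q \<circ> (arefl (pullback q h) \<circ> arefl q)"
      by (simp add: fun_eq_iff arefl_pullback)
    ultimately have "set (us @ vs @ us) \<subseteq> simple \<and> arefl h = word (us @ vs @ us)"
      by (simp add: word_append)
    then show ?thesis by blast
  qed
qed

lemma simple_word:
  assumes "set hs \<subseteq> H"
  shows "\<exists>us. set us \<subseteq> simple \<and> word hs = word us"
  using assms
proof (induction hs)
  case Nil
  show ?case by (intro exI [of _ "[]"]) simp
next
  case (Cons h hs)
  then obtain us vs where "set us \<subseteq> simple" "word hs = word us"
    "set vs \<subseteq> simple" "arefl h = word vs"
    using arefl_simple_word [of h] by auto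
  then show ?case by (intro exI [of _ "vs @ us"]) (simp add: word_append)
qed

text \<open>Iterating \<open>pullback\<close> over the letters: a hyperplane viewed from
  \<open>word hs x\<close> becomes a member of \<open>H\<close> viewed from
  \<open>x\<close>.\<close>

lemma pullback_word:
  assumes "set hs \<subseteq> H" "h \<in> H"
  shows "\<exists>h'\<in>H. (\<forall>x. aff h' x = aff h (word hs x)) \<and>
    (\<forall>x. word hs (arefl h' x) = arefl h (word hs x))"
  using assms
proof (induction hs arbitrary: h)
  case (Cons g hs)
  then have "pullback g h \<in> H" by (simp add: pullback_closed)
  with Cons obtain h' where "h' \<in> H" "\<forall>x. aff h' x = aff (pullback g h) (word hs x)"
    "\<forall>x. word hs (arefl h' x) = arefl (pullback g h) (word hs x)"
    by (metis list.set_intros(2) subset_code(1))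
  then show ?case by (intro bexI [of _ h']) (simp_all add: aff_pullback arefl_pullback)
qed auto

lemma simple_subset: "simple \<subseteq> H"
  by (auto simp: simple_def)

text \<open>A closed gallery crosses its first wall a second time; folding the part between the two
  crossings shortens the word by two letters.\<close>

lemma shorten_word:
  assumes us: "set us \<subseteq> simple" "us \<noteq> []"
    and nosep: "\<And>h. h \<in> H \<Longrightarrow> 0 \<le> aff h p * aff h (word us p)"
  shows "\<exists>vs. set vs \<subseteq> simple \<and> length vs < length us \<and> word vs = word us"
proof -
  obtain h hs where uh: "us = h # hs" using us by (cases us) auto
  then have h: "h \<in> simple" "h \<in> H" using us simple_subset by auto
  define P where "P i = word (take i us) p" for i
  define side where "side i \<longleftrightarrow> 0 < aff h p * aff h (P i)" for i
  have Hs: "set us \<subseteq> H" using us simple_subset by blast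
  \<comment> \<open>Pulled back along the prefix, \<open>h\<close> becomes a member of
    \<open>H\<close>, and \<open>p\<close> lies on none of these.\<close>
  have nz: "aff h (P i) \<noteq> 0" for i
  proof -
    obtain h' where "h' \<in> H" "aff h' p = aff h (P i)"
      using pullback_word [of "take i us" h] Hs h set_take_subset [of i us]
      unfolding P_def by (metis subset_trans)
    then show ?thesis using regular by metis
  qed
  have np: "aff h p \<noteq> 0" using regular h by blast
  have "\<not> side 1"
    using normal_nonzero [OF h(2)] by (simp add: side_def P_def uh aff_arefl_self not_less)
  moreover have "side (length us)"
    using nosep [OF h(2)] nz [of "length us"] np by (simp add: side_def P_def order_less_le)
  moreover have "1 \<le> length us" by (simp add: uh)
  \<comment> \<open>Discrete intermediate value: the first letter takes \<open>p\<close> across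
    \<open>h\<close>, and by \<open>nosep\<close> the whole word ends on the side of
    \<open>p\<close>.\<close>
  ultimately obtain i where i: "1 \<le> i" "i < length us" "\<not> side i" "side (Suc i)"
  proof -
    assume a: "\<not> side 1" "side (length us)" "1 \<le> length us"
      and that: "\<And>i. 1 \<le> i \<Longrightarrow> i < length us \<Longrightarrow> \<not> side i \<Longrightarrow> side (Suc i) \<Longrightarrow> thesis"
    have "\<exists>i. 1 \<le> i \<and> i < length us \<and> \<not> side i \<and> side (Suc i)"
    proof (rule ccontr)
      assume n: "\<not> ?thesis"
      have "1 \<le> j \<Longrightarrow> j \<le> length us \<Longrightarrow> \<not> side j" for j
      proof (induction j)
        case (Suc j)
        show ?case
        proof (cases "j = 0")
          case False
          then have "1 \<le> j" "j < length us" "\<not> side j" using Suc by auto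
          then show ?thesis using n by blast
        qed (use a in simp)
      qed simp
      then show False using a by blast
    qed
    then show thesis using that by blast
  qed
  define ws s rest where "ws = take i us" and "s = us ! i" and "rest = drop (Suc i) us"
  have split: "us = ws @ s # rest" using i by (simp add: ws_def s_def rest_def id_take_nth_drop)
  have tk: "take (Suc i) us = ws @ [s]" using i by (simp add: ws_def s_def take_Suc_conv_app_nth)
  have s: "s \<in> simple" using us split by auto
  have wsH: "set ws \<subseteq> H" using Hs split by auto
  obtain h' where h': "h' \<in> H" "\<And>x. aff h' x = aff h (word ws x)"
    "\<And>x. word ws (arefl h' x) = arefl h (word ws x)"
    using pullback_word [OF wsH h(2)] by blast
  \<comment> \<open>The gallery crosses \<open>h\<close> between \<open>P i\<close> and
    \<open>P (Suc i)\<close>. Pulled back along \<open>ws\<close>, this says that \<open>h'\<close>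
    separates \<open>p\<close> from \<open>arefl s p\<close>; as \<open>s\<close> is simple,
    \<open>h'\<close> and \<open>s\<close> have the same reflection.\<close>
  have "aff h' p * aff h' (arefl s p) < 0"
  proof -
    have "aff h p * aff h (P i) < 0" using i(3) nz [of i] np
      by (simp add: side_def not_less order_less_le)
    moreover have "0 < aff h p * aff h (P (Suc i))" using i(4) by (simp add: side_def)
    ultimately have "aff h (P i) * aff h (P (Suc i)) < 0"
      by (auto simp: mult_less_0_iff zero_less_mult_iff)
    then show ?thesis by (simp add: h' P_def tk word_append ws_def [symmetric])
  qed
  then have "arefl h' = arefl s" using s h' by (auto simp: simple_def)
  then have comm: "word ws (arefl s x) = arefl h (word ws x)" for x using h'(3) by metis
  obtain ws' where ws': "ws = h # ws'" using i by (cases i) (auto simp: ws_def uh)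
  \<comment> \<open>Moving \<open>s\<close> to the left through \<open>ws\<close> turns it into
    \<open>h\<close>, which cancels the first letter of \<open>ws\<close>.\<close>
  have "word us = word (ws' @ rest)"
    by (simp add: split word_append fun_eq_iff comm) (simp add: ws')
  moreover have "set (ws' @ rest) \<subseteq> simple" using us(1) unfolding split ws' by auto
  moreover have "length (ws' @ rest) < length us" by (simp add: split ws')
  ultimately show ?thesis by metis
qed

text \<open>The group acts freely on chambers: a word in simple reflections for the same map can be
  shortened until it is empty.\<close>

lemma not_separated_imp_id:
  assumes "set hs \<subseteq> H" "\<And>h. h \<in> H \<Longrightarrow> 0 \<le> aff h p * aff h (word hs p)"
  shows "word hs = id"
proof -
  have "word us = id" if "set us \<subseteq> simple" "word us = word hs" for us
    using that
  proof (induction "length us" arbitrary: us rule: less_induct)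
    case less
    show ?case
    proof (cases "us = []")
      case False
      then obtain vs where "set vs \<subseteq> simple" "length vs < length us" "word vs = word us"
        using shorten_word [OF less.prems(1)] assms(2) less.prems(2) by auto
      then show ?thesis using less.hyps less.prems by metis
    qed simp
  qed
  then show ?thesis using simple_word [OF assms(1)] by metis
qed

end

section \<open>Root systems\<close>

lemma weyl_inner: "w \<in> weyl_group R \<Longrightarrow> w x \<bullet> w y = x \<bullet> y"
  using weyl_group_orthogonal orthogonal_transformation_def by blast

lemma weyl_linear: "w \<in> weyl_group R \<Longrightarrow> linear w"
  using weyl_group_orthogonal orthogonal_transformation_def by blast

lemma weyl_inv:
  assumes "w \<in> weyl_group R"
  shows "inv w (w x) = x" "w (inv w x) = x"
  using orthogonal_transformation_bij [OF weyl_group_orthogonal [OF assms]]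
  by (simp_all add: bij_is_inj bij_is_surj surj_f_inv_f)

lemma weyl_inner_left: "w \<in> weyl_group R \<Longrightarrow> x \<bullet> w y = inv w x \<bullet> y"
  using weyl_inner [of w R "inv w x" y] by (simp add: weyl_inv)

lemma weyl_comp: "v \<in> weyl_group R \<Longrightarrow> w \<in> weyl_group R \<Longrightarrow> (\<lambda>x. v (w x)) \<in> weyl_group R"
  using weyl_group.comp [of v R w] by (simp add: o_def)

lemma weyl_diff_in_span: "w \<in> weyl_group R \<Longrightarrow> w x - x \<in> span R"
proof (induction arbitrary: x rule: weyl_group.induct)
  case id
  show ?case by (simp add: span_zero)
next
  case (refl \<alpha>)
  then show ?case by (simp add: reflection_def span_neg span_scale span_base)
next
  case (comp v w)
  then have "(v (w x) - w x) + (w x - x) \<in> span R" by (intro span_add)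
  then show ?case by simp
qed

section \<open>Generic points and small perturbations\<close>

lemma finite_avoid_hyperplanes:
  fixes F :: "'a::euclidean_space set"
  assumes "finite F" "0 \<notin> F"
  shows "\<exists>x. \<forall>\<alpha>\<in>F. \<alpha> \<bullet> x \<noteq> 0"
  using assms
proof (induction F rule: finite_induct)
  case (insert \<alpha> F)
  then obtain x where x: "\<forall>\<beta>\<in>F. \<beta> \<bullet> x \<noteq> 0" by auto
  \<comment> \<open>Moving \<open>x\<close> by \<open>t\<close> along \<open>\<alpha>\<close>, each
    vector not orthogonal to \<open>\<alpha>\<close> excludes one \<open>t\<close>. For orthogonal
    ones division by zero yields 0, a harmless extra exclusion.\<close>
  have "finite (insert (- (\<alpha> \<bullet> x) / (\<alpha> \<bullet> \<alpha>)) ((\<lambda>\<beta>. - (\<beta> \<bullet> x) / (\<beta> \<bullet> \<alpha>)) ` F))"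
    using insert by simp
  then obtain t where t: "t \<notin> insert (- (\<alpha> \<bullet> x) / (\<alpha> \<bullet> \<alpha>)) ((\<lambda>\<beta>. - (\<beta> \<bullet> x) / (\<beta> \<bullet> \<alpha>)) ` F)"
    using ex_new_if_finite [OF infinite_UNIV_char_0] by blast
  have "\<beta> \<bullet> (x + t *\<^sub>R \<alpha>) \<noteq> 0" if "\<beta> \<in> insert \<alpha> F" for \<beta>
  proof
    assume 0: "\<beta> \<bullet> (x + t *\<^sub>R \<alpha>) = 0"
    show False
    proof (cases "\<beta> \<bullet> \<alpha> = 0")
      case True
      then show False using 0 x that insert.prems by (auto simp: inner_add_right)
    next
      case False
      then have "t = - (\<beta> \<bullet> x) / (\<beta> \<bullet> \<alpha>)"
        using 0 by (simp add: inner_add_right field_simps)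
      then show False using t that by auto
    qed
  qed
  then show ?case by blast
qed simp

lemma eventually_same_sign:
  fixes x z :: "'a::euclidean_space"
  assumes "\<alpha> \<bullet> x \<noteq> 0"
  shows "\<forall>\<^sub>F t in at_right 0. 0 < (\<alpha> \<bullet> x) * (\<alpha> \<bullet> (x + t *\<^sub>R z))"
proof -
  have "((\<lambda>t. (\<alpha> \<bullet> x) * (\<alpha> \<bullet> (x + t *\<^sub>R z))) \<longlongrightarrow> (\<alpha> \<bullet> x) * (\<alpha> \<bullet> (x + 0 *\<^sub>R z))) (at_right 0)"
    by (intro tendsto_intros)
  moreover have "0 < (\<alpha> \<bullet> x) * (\<alpha> \<bullet> (x + 0 *\<^sub>R z))"
    using assms by (metis add.right_neutral not_real_square_gt_zero scaleR_zero_left)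
  ultimately show ?thesis by (rule order_tendstoD(1))
qed

lemma finite_eventually_same_sign:
  fixes x z :: "'a::euclidean_space"
  assumes "finite R"
  shows "\<forall>\<^sub>F t in at_right 0. \<forall>\<alpha>\<in>R. \<alpha> \<bullet> x \<noteq> 0 \<longrightarrow> 0 < (\<alpha> \<bullet> x) * (\<alpha> \<bullet> (x + t *\<^sub>R z))"
  using assms by (auto intro!: eventually_ball_finite eventually_same_sign)

section \<open>Irreducible components\<close>

text \<open>The connected component of \<open>\<alpha>\<close> in the graph joining non-orthogonal
  roots.\<close>

definition component :: "'a::euclidean_space set \<Rightarrow> 'a \<Rightarrow> 'a set" where
  "component R \<alpha> = {(\<beta>, \<gamma>). \<beta> \<in> R \<and> \<gamma> \<in> R \<and> \<beta> \<bullet> \<gamma> \<noteq> 0}\<^sup>* `` {\<alpha>}"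

lemma component_self: "\<alpha> \<in> component R \<alpha>"
  by (simp add: component_def)

lemma component_step:
  "\<beta> \<in> component R \<alpha> \<Longrightarrow> \<beta> \<in> R \<Longrightarrow> \<gamma> \<in> R \<Longrightarrow> \<beta> \<bullet> \<gamma> \<noteq> 0 \<Longrightarrow> \<gamma> \<in> component R \<alpha>"
  unfolding component_def by (auto intro: rtrancl_into_rtrancl)

lemma component_subset:
  assumes "\<alpha> \<in> R"
  shows "component R \<alpha> \<subseteq> R"
proof
  fix \<beta> assume "\<beta> \<in> component R \<alpha>"
  then have "(\<alpha>, \<beta>) \<in> {(\<beta>, \<gamma>). \<beta> \<in> R \<and> \<gamma> \<in> R \<and> \<beta> \<bullet> \<gamma> \<noteq> 0}\<^sup>*" by (simp add: component_def)
  then show "\<beta> \<in> R" by (induction rule: rtrancl_induct) (use assms in auto)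
qed

lemma component_cong:
  assumes "\<alpha> \<in> R" "\<beta> \<in> R" "\<alpha> \<bullet> \<beta> \<noteq> 0"
  shows "component R \<alpha> = component R \<beta>"
proof -
  have "component R y \<subseteq> component R x" if "x \<in> R" "y \<in> R" "x \<bullet> y \<noteq> 0" for x y
    unfolding component_def using that by (auto intro: converse_rtrancl_into_rtrancl)
  from this [of \<alpha> \<beta>] this [of \<beta> \<alpha>] show ?thesis using assms by (simp add: inner_commute)
qed

lemma irreducible_component_component:
  assumes "\<alpha> \<in> R"
  shows "irreducible_component R (component R \<alpha>)"
proof -
  \<comment> \<open>An orthogonal splitting cuts no edge, so induction along paths keeps them in the
    part containing \<open>\<alpha>\<close>.\<close>
  have all: "component R \<alpha> \<subseteq> A"
    if "\<alpha> \<in> A" "A \<union> B = component R \<alpha>" "\<And>x y. x \<in> A \<Longrightarrow> y \<in> B \<Longrightarrow> x \<bullet> y = 0" for A B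
  proof
    fix \<beta> assume "\<beta> \<in> component R \<alpha>"
    then have "(\<alpha>, \<beta>) \<in> {(\<beta>, \<gamma>). \<beta> \<in> R \<and> \<gamma> \<in> R \<and> \<beta> \<bullet> \<gamma> \<noteq> 0}\<^sup>*" by (simp add: component_def)
    then show "\<beta> \<in> A"
    proof (induction rule: rtrancl_induct)
      case (step y z)
      then have "y \<in> component R \<alpha>" "y \<in> R" "z \<in> R" "y \<bullet> z \<noteq> 0"
        using that(2) by auto
      then have "z \<in> component R \<alpha>" by (rule component_step)
      then show ?case using step that by auto
    qed (use that in simp)
  qed
  have "irreducible_roots (component R \<alpha>)"
    unfolding irreducible_roots_def
  proof (intro conjI notI)
    show "component R \<alpha> = {} \<Longrightarrow> False" using component_self by blast
    assume "\<exists>A B. A \<noteq> {} \<and> B \<noteq> {} \<and> A \<union> B = component R \<alpha> \<and> A \<inter> B = {} \<and>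
      (\<forall>\<alpha>\<in>A. \<forall>\<beta>\<in>B. \<alpha> \<bullet> \<beta> = 0)"
    then obtain A B where AB: "A \<noteq> {}" "B \<noteq> {}" "A \<union> B = component R \<alpha>" "A \<inter> B = {}"
      and "\<forall>\<alpha>\<in>A. \<forall>\<beta>\<in>B. \<alpha> \<bullet> \<beta> = 0"
      by (elim exE conjE) (rule that)
    then have orth: "x \<in> A \<Longrightarrow> y \<in> B \<Longrightarrow> x \<bullet> y = 0" for x y by simp
    have "\<alpha> \<in> A \<or> \<alpha> \<in> B" using AB(3) component_self by blast
    then show False
    proof
      assume "\<alpha> \<in> A"
      then show False using all [of A B, OF _ AB(3) orth] AB by auto
    next
      assume "\<alpha> \<in> B"
      moreover have "x \<bullet> y = 0" if "x \<in> B" "y \<in> A" for x y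
        using orth [of y x] that by (simp add: inner_commute)
      ultimately have "component R \<alpha> \<subseteq> B" using all [of B A] AB(3) by blast
      then show False using AB by blast
    qed
  qed
  then show ?thesis
    unfolding irreducible_component_def
    using component_subset [OF assms] component_step by blast
qed

text \<open>The constant \<open>c \<alpha>\<close> of the outline, later the spacing of parallel
  hyperplanes.\<close>

definition bound :: "'a::euclidean_space set \<Rightarrow> 'a \<Rightarrow> 'a \<Rightarrow> real" where
  "bound R a \<alpha> = Max ((\<lambda>\<beta>. \<bar>\<beta> \<bullet> a\<bar>) ` component R \<alpha>)"

section \<open>Root values on a minuscule element and the affine walls\<close>

locale minuscule_root_system =
  fixes R :: "'a::euclidean_space set" and a :: 'a
  assumes rs: "root_system R" and minuscule: "minuscule R a"
begin

abbreviation "W \<equiv> weyl_group R"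

lemma finite_R: "finite R" and zero_notin_R: "0 \<notin> R"
  using rs by (auto simp: root_system_def)

lemma reflection_root: "\<alpha> \<in> R \<Longrightarrow> \<beta> \<in> R \<Longrightarrow> reflection \<alpha> \<beta> \<in> R"
  using rs unfolding root_system_def by blast

lemma cartan_integer: "\<alpha> \<in> R \<Longrightarrow> \<beta> \<in> R \<Longrightarrow> 2 * (\<alpha> \<bullet> \<beta>) / (\<alpha> \<bullet> \<alpha>) \<in> \<int>"
  using rs unfolding root_system_def by blast

lemma weyl_root: "w \<in> W \<Longrightarrow> \<alpha> \<in> R \<Longrightarrow> w \<alpha> \<in> R"
  by (induction arbitrary: \<alpha> rule: weyl_group.induct) (auto simp: reflection_root)

lemma uminus_root: "\<alpha> \<in> R \<Longrightarrow> - \<alpha> \<in> R"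
  using reflection_root [of \<alpha> \<alpha>] zero_notin_R
  by (cases "\<alpha> = 0") (auto simp: reflection_def scaleR_2)

text \<open>Differences of orbit points lie in \<open>span R\<close>, so the values of the roots
  determine an orbit point. As \<open>W\<close> permutes the roots, these values come from a finite
  set.\<close>

lemma finite_orbit: "finite ((\<lambda>w. w x) ` W)"
proof (rule inj_on_finite)
  show "inj_on (\<lambda>y. \<lambda>\<alpha>\<in>R. \<alpha> \<bullet> y) ((\<lambda>w. w x) ` W)"
  proof (intro inj_onI, elim imageE)
    fix y y' v w
    assume eq: "(\<lambda>\<alpha>\<in>R. \<alpha> \<bullet> y) = (\<lambda>\<alpha>\<in>R. \<alpha> \<bullet> y')" and vw: "y = v x" "v \<in> W" "y' = w x" "w \<in> W"
    have "(v x - x) - (w x - x) \<in> span R"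
      using vw by (intro span_diff weyl_diff_in_span)
    then have "y - y' \<in> span R" using vw by simp
    moreover have "orthogonal (y - y') \<alpha>" if "\<alpha> \<in> R" for \<alpha>
      using fun_cong [OF eq, of \<alpha>] that
      by (simp add: orthogonal_def inner_commute [of _ \<alpha>] inner_diff_right)
    ultimately have "orthogonal (y - y') (y - y')" by (rule orthogonal_to_span)
    then show "y = y'" by (simp add: orthogonal_def)
  qed
  show "(\<lambda>y. \<lambda>\<alpha>\<in>R. \<alpha> \<bullet> y) ` ((\<lambda>w. w x) ` W) \<subseteq> PiE R (\<lambda>_. (\<lambda>\<beta>. \<beta> \<bullet> x) ` R)"
    by (auto simp: weyl_inner_left weyl_root weyl_group_inv)
  show "finite (PiE R (\<lambda>_. (\<lambda>\<beta>. \<beta> \<bullet> x) ` R))"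
    by (intro finite_PiE finite_R finite_imageI)
qed

text \<open>Maximise \<open>h x \<bullet> p\<close> over the \<open>h\<close> fixing
  \<open>z\<close>. The reflection in a root orthogonal to \<open>z\<close> also fixes
  \<open>z\<close>, and maximality compares \<open>h x\<close> with its mirror image.\<close>

lemma exists_dominant_conjugate:
  "\<exists>h\<in>W. h z = z \<and> (\<forall>\<alpha>\<in>R. \<alpha> \<bullet> z = 0 \<longrightarrow> 0 \<le> (\<alpha> \<bullet> h x) * (\<alpha> \<bullet> p))"
proof -
  define F where "F = {h x |h. h \<in> W \<and> h z = z}"
  have "finite F" by (rule finite_subset [OF _ finite_orbit [of x]]) (auto simp: F_def)
  moreover have "x \<in> F" unfolding F_def using weyl_group.id [of R]
    by (intro CollectI exI [of _ id]) simp
  ultimately obtain y where y: "y \<in> F" "\<And>y'. y' \<in> F \<Longrightarrow> y' \<bullet> p \<le> y \<bullet> p"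
    using Max_in [of "(\<lambda>y. y \<bullet> p) ` F"] Max_ge [of "(\<lambda>y. y \<bullet> p) ` F"]
    by (metis (no_types, lifting) empty_iff finite_imageI image_iff image_is_empty)
  then obtain h where h: "h \<in> W" "h z = z" "y = h x" by (auto simp: F_def)
  have "0 \<le> (\<alpha> \<bullet> h x) * (\<alpha> \<bullet> p)" if \<alpha>: "\<alpha> \<in> R" "\<alpha> \<bullet> z = 0" for \<alpha>
  proof -
    have "reflection \<alpha> \<circ> h \<in> W" using h \<alpha> by (intro weyl_group.comp weyl_group.refl)
    moreover have "(reflection \<alpha> \<circ> h) z = z" using h \<alpha> by (simp add: reflection_def)
    ultimately have "reflection \<alpha> y \<in> F"
      unfolding F_def by (intro CollectI exI [of _ "reflection \<alpha> \<circ> h"]) (simp add: h)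
    then have "reflection \<alpha> y \<bullet> p \<le> y \<bullet> p" by (rule y)
    then have "0 \<le> 2 * (\<alpha> \<bullet> y) * (\<alpha> \<bullet> p) / (\<alpha> \<bullet> \<alpha>)"
      by (simp add: reflection_def inner_diff_left)
    moreover have "0 < \<alpha> \<bullet> \<alpha>" using \<alpha> zero_notin_R by auto
    ultimately show ?thesis by (simp add: h zero_le_divide_iff mult.commute mult.left_commute)
  qed
  then show ?thesis using h by blast
qed

lemma finite_component: "\<alpha> \<in> R \<Longrightarrow> finite (component R \<alpha>)"
  using component_subset finite_R finite_subset by blast

lemma abs_le_bound: "\<alpha> \<in> R \<Longrightarrow> \<bar>\<alpha> \<bullet> a\<bar> \<le> bound R a \<alpha>"
  unfolding bound_def by (intro Max_ge) (auto simp: finite_component component_self)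

lemma bound_nonneg: "\<alpha> \<in> R \<Longrightarrow> 0 \<le> bound R a \<alpha>"
  using abs_le_bound [of \<alpha>] by linarith

lemma bound_cong: "\<alpha> \<in> R \<Longrightarrow> \<beta> \<in> R \<Longrightarrow> \<alpha> \<bullet> \<beta> \<noteq> 0 \<Longrightarrow> bound R a \<alpha> = bound R a \<beta>"
  unfolding bound_def using component_cong by metis

text \<open>The values on a component are closed under negation. A nonzero value of non-maximal
  modulus, a value of maximal modulus and their negatives would be four distinct values.\<close>

lemma inner_minuscule:
  assumes \<alpha>: "\<alpha> \<in> R"
  shows "\<alpha> \<bullet> a = 0 \<or> \<bar>\<alpha> \<bullet> a\<bar> = bound R a \<alpha>"
proof (rule ccontr)
  assume n: "\<not> ?thesis"
  define X where "X = {\<beta> \<bullet> a |\<beta>. \<beta> \<in> component R \<alpha>}"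
  have X: "finite X" "card X \<le> 3"
    using minuscule irreducible_component_component [OF \<alpha>] unfolding minuscule_def X_def by blast+
  have neg: "- x \<in> X" if "x \<in> X" for x
  proof -
    obtain \<beta> where \<beta>: "\<beta> \<in> component R \<alpha>" "x = \<beta> \<bullet> a" using \<open>x \<in> X\<close> unfolding X_def by blast
    then have "\<beta> \<in> R" using component_subset \<alpha> by blast
    then have "- \<beta> \<in> R" "\<beta> \<bullet> - \<beta> \<noteq> 0" using zero_notin_R uminus_root by auto
    with \<beta>(1) \<open>\<beta> \<in> R\<close> have "- \<beta> \<in> component R \<alpha>" by (rule component_step)
    moreover have "- x = - \<beta> \<bullet> a" using \<beta> by simp
    ultimately show ?thesis unfolding X_def by blast
  qed
  have "bound R a \<alpha> \<in> (\<lambda>\<beta>. \<bar>\<beta> \<bullet> a\<bar>) ` component R \<alpha>"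
    unfolding bound_def using finite_component [OF \<alpha>] component_self by (intro Max_in) auto
  then obtain \<gamma> where \<gamma>: "\<gamma> \<in> component R \<alpha>" "bound R a \<alpha> = \<bar>\<gamma> \<bullet> a\<bar>" by auto
  have in_X: "\<gamma> \<bullet> a \<in> X" "\<alpha> \<bullet> a \<in> X" using \<gamma> component_self by (auto simp: X_def)
  have "{\<gamma> \<bullet> a, - (\<gamma> \<bullet> a), \<alpha> \<bullet> a, - (\<alpha> \<bullet> a)} \<subseteq> X" using in_X neg by blast
  then have "card {\<gamma> \<bullet> a, - (\<gamma> \<bullet> a), \<alpha> \<bullet> a, - (\<alpha> \<bullet> a)} \<le> 3"
    using card_mono [OF X(1)] X(2) order_trans by blast
  moreover have "card {\<gamma> \<bullet> a, - (\<gamma> \<bullet> a), \<alpha> \<bullet> a, - (\<alpha> \<bullet> a)} = 4"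
  proof -
    have "\<gamma> \<bullet> a \<noteq> 0" using n \<gamma> abs_le_bound [OF \<alpha>] by auto
    moreover have "\<alpha> \<bullet> a \<noteq> 0" "\<alpha> \<bullet> a \<noteq> \<gamma> \<bullet> a" "\<alpha> \<bullet> a \<noteq> - (\<gamma> \<bullet> a)" using n \<gamma> by auto
    ultimately show ?thesis by (auto simp: card_insert_if)
  qed
  ultimately show False by simp
qed

text \<open>If the reflection in \<open>\<beta>\<close> moves \<open>\<alpha>\<close>, then
  \<open>\<beta>\<close> is orthogonal neither to \<open>\<alpha>\<close> nor to its image, so all
  three share a component.\<close>

lemma bound_weyl:
  assumes "w \<in> W" "\<alpha> \<in> R"
  shows "bound R a (w \<alpha>) = bound R a \<alpha>"
  using assms
proof (induction arbitrary: \<alpha> rule: weyl_group.induct)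
  case (refl \<beta>)
  show ?case
  proof (cases "\<beta> \<bullet> \<alpha> = 0")
    case False
    have "\<beta> \<bullet> reflection \<beta> \<alpha> = - (\<beta> \<bullet> \<alpha>)" using refl zero_notin_R
      by (auto simp: reflection_def inner_diff_right)
    then show ?thesis
      using bound_cong [of \<beta> "reflection \<beta> \<alpha>"] bound_cong [of \<beta> \<alpha>] False refl reflection_root
      by simp
  qed (simp add: reflection_def)
qed (auto simp: weyl_root)

text \<open>Transferring \<open>w\<close> to the root reduces both claims to \<open>a\<close>
  itself. Integrality makes translated reflections wall reflections; the estimate controls signs
  near \<open>b\<close>.\<close>

lemma inner_weyl_minuscule:
  assumes "\<alpha> \<in> R" "w \<in> W"
  shows "\<exists>k. \<alpha> \<bullet> w a = of_int k * bound R a \<alpha>" "\<bar>\<alpha> \<bullet> w a\<bar> \<le> bound R a \<alpha>"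
proof -
  have i: "inv w \<in> W" "inv w \<alpha> \<in> R" using assms by (auto intro: weyl_group_inv weyl_root)
  have eq: "\<alpha> \<bullet> w a = inv w \<alpha> \<bullet> a" "bound R a (inv w \<alpha>) = bound R a \<alpha>"
    using assms i by (simp_all add: weyl_inner_left bound_weyl)
  show "\<bar>\<alpha> \<bullet> w a\<bar> \<le> bound R a \<alpha>" using abs_le_bound i eq by metis
  consider "\<alpha> \<bullet> w a = 0" | "\<alpha> \<bullet> w a = bound R a \<alpha>" | "\<alpha> \<bullet> w a = - bound R a \<alpha>"
    using inner_minuscule [OF i(2)] unfolding eq by linarith
  then show "\<exists>k. \<alpha> \<bullet> w a = of_int k * bound R a \<alpha>"
  proof cases
    case 1 then show ?thesis by (intro exI [of _ 0]) simp
  next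
    case 2 then show ?thesis by (intro exI [of _ 1]) simp
  next
    case 3 then show ?thesis by (intro exI [of _ "- 1"]) simp
  qed
qed

text \<open>On a component orthogonal to \<open>a\<close> the spacing \<open>bound R a \<alpha>\<close> is zero, and only the linear
  hyperplanes remain.\<close>

definition walls :: "('a \<times> real) set" where
  "walls = {(\<alpha>, of_int k * bound R a \<alpha>) |\<alpha> k. \<alpha> \<in> R}"

lemma wallsI: "\<alpha> \<in> R \<Longrightarrow> (\<alpha>, of_int k * bound R a \<alpha>) \<in> walls"
  by (auto simp: walls_def)

text \<open>The level changes by \<open>k * n\<close> spacings of \<open>\<alpha>\<close>, with
  \<open>n\<close> the Cartan integer; if \<open>n\<close> is nonzero, both roots have the same
  spacing.\<close>

lemma walls_pullback:
  assumes "h \<in> walls" "h' \<in> walls"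
  shows "pullback h h' \<in> walls"
proof -
  obtain \<alpha> k \<beta> m where h: "h = (\<alpha>, of_int k * bound R a \<alpha>)" "\<alpha> \<in> R"
    "h' = (\<beta>, of_int m * bound R a \<beta>)" "\<beta> \<in> R"
    using assms by (auto simp: walls_def)
  obtain n where n: "2 * (\<alpha> \<bullet> \<beta>) / (\<alpha> \<bullet> \<alpha>) = of_int n"
    using cartan_integer h by (metis Ints_cases)
  have "n = 0 \<or> bound R a \<alpha> = bound R a \<beta>"
    using n bound_cong [of \<alpha> \<beta>] h by (cases "\<alpha> \<bullet> \<beta> = 0") auto
  moreover have "snd (pullback h h') = of_int m * bound R a \<beta> - (of_int k * bound R a \<alpha>) * of_int n"
    by (simp add: pullback_def h flip: n)
  ultimately have "snd (pullback h h') = of_int (m - k * n) * bound R a (reflection \<alpha> \<beta>)"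
    using bound_weyl [OF weyl_group.refl] h by (auto simp: algebra_simps)
  moreover have "fst (pullback h h') = reflection \<alpha> \<beta>" by (simp add: pullback_def h)
  ultimately have "pullback h h' = (reflection \<alpha> \<beta>, of_int (m - k * n) * bound R a (reflection \<alpha> \<beta>))"
    by (metis prod.collapse)
  then show ?thesis using wallsI reflection_root h by metis
qed

lemma walls_locally_finite: "finite {h \<in> walls. \<bar>aff h x\<bar> \<le> K * norm (fst h)}"
proof -
  \<comment> \<open>Finiteness is claimed for the image, since for spacing zero infinitely many
    \<open>k\<close> may give the same pair.\<close>
  have fin: "finite ((\<lambda>k. (\<alpha>, of_int k * bound R a \<alpha>)) `
      {k. \<bar>\<alpha> \<bullet> x - of_int k * bound R a \<alpha>\<bar> \<le> M})" for \<alpha> M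
  proof (cases "bound R a \<alpha> = 0")
    case True
    then have "(\<lambda>k. (\<alpha>, of_int k * bound R a \<alpha>)) ` A \<subseteq> {(\<alpha>, 0)}" for A by auto
    then show ?thesis by (rule finite_subset) simp
  next
    case False
    have "{k. \<bar>\<alpha> \<bullet> x - of_int k * bound R a \<alpha>\<bar> \<le> M} \<subseteq>
      {k. \<bar>real_of_int k\<bar> \<le> (M + \<bar>\<alpha> \<bullet> x\<bar>) / \<bar>bound R a \<alpha>\<bar>}"
    proof
      fix k assume "k \<in> {k. \<bar>\<alpha> \<bullet> x - of_int k * bound R a \<alpha>\<bar> \<le> M}"
      then have "\<bar>real_of_int k * bound R a \<alpha>\<bar> \<le> M + \<bar>\<alpha> \<bullet> x\<bar>"
        unfolding mem_Collect_eq by linarith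
      then show "k \<in> {k. \<bar>real_of_int k\<bar> \<le> (M + \<bar>\<alpha> \<bullet> x\<bar>) / \<bar>bound R a \<alpha>\<bar>}"
        using False by (simp add: abs_mult pos_le_divide_eq)
    qed
    moreover have "finite {k. \<bar>real_of_int k\<bar> \<le> L}" for L
    proof (rule finite_subset)
      show "{k. \<bar>real_of_int k\<bar> \<le> L} \<subseteq> {- \<lceil>L\<rceil>..\<lceil>L\<rceil>}"
        by auto linarith+
    qed simp
    ultimately show ?thesis by (meson finite_imageI finite_subset)
  qed
  have "finite (\<Union>\<alpha>\<in>R. (\<lambda>k. (\<alpha>, of_int k * bound R a \<alpha>)) `
      {k. \<bar>\<alpha> \<bullet> x - of_int k * bound R a \<alpha>\<bar> \<le> K * norm \<alpha>})"
    using finite_R fin by blast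
  then show ?thesis
  proof (rule rev_finite_subset, intro subsetI)
    fix h assume h: "h \<in> {h \<in> walls. \<bar>aff h x\<bar> \<le> K * norm (fst h)}"
    then obtain \<alpha> k where \<alpha>: "h = (\<alpha>, of_int k * bound R a \<alpha>)" "\<alpha> \<in> R" by (auto simp: walls_def)
    show "h \<in> (\<Union>\<alpha>\<in>R. (\<lambda>k. (\<alpha>, of_int k * bound R a \<alpha>)) `
        {k. \<bar>\<alpha> \<bullet> x - of_int k * bound R a \<alpha>\<bar> \<le> K * norm \<alpha>})"
      using h \<alpha> by (intro UN_I [OF \<alpha>(2)] image_eqI [where x = k]) (simp_all add: aff_def)
  qed
qed

lemma walls_gap: "\<exists>\<mu>>0. \<forall>h\<in>walls. aff h x \<noteq> 0 \<longrightarrow> \<mu> \<le> \<bar>aff h x\<bar>"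
proof -
  \<comment> \<open>The factor \<open>1 / norm \<alpha>\<close> turns the condition into
    \<open>\<bar>aff h x\<bar> \<le> 1\<close> for walls with normal \<open>\<alpha>\<close>; the 1
    inserted below covers all remaining walls.\<close>
  define F where "F = (\<Union>\<alpha>\<in>R. {h \<in> walls. \<bar>aff h x\<bar> \<le> (1 / norm \<alpha>) * norm (fst h)})"
  have "finite F" unfolding F_def using finite_R walls_locally_finite by blast
  then have fin: "finite (insert 1 ((\<lambda>h. \<bar>aff h x\<bar>) ` {h \<in> F. aff h x \<noteq> 0}))" by simp
  define \<mu> where "\<mu> = Min (insert 1 ((\<lambda>h. \<bar>aff h x\<bar>) ` {h \<in> F. aff h x \<noteq> 0}))"
  have "\<mu> > 0" unfolding \<mu>_def using fin by (subst Min_gr_iff) auto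
  moreover have "\<mu> \<le> \<bar>aff h x\<bar>" if "h \<in> walls" "aff h x \<noteq> 0" for h
  proof (cases "\<bar>aff h x\<bar> \<le> 1")
    case True
    have "fst h \<in> R" using that by (auto simp: walls_def)
    moreover have "norm (fst h) \<noteq> 0" using calculation zero_notin_R by auto
    ultimately have "h \<in> F" using that True by (auto simp: F_def intro!: bexI [of _ "fst h"])
    then show ?thesis unfolding \<mu>_def using that by (intro Min_le [OF fin]) auto
  next
    case False
    have "\<mu> \<le> 1" unfolding \<mu>_def by (intro Min_le [OF fin]) auto
    then show ?thesis using False by simp
  qed
  ultimately show ?thesis by blast
qed

section \<open>Affine maps as products of wall reflections\<close>

lemma weyl_word:
  assumes "w \<in> W"
  shows "\<exists>hs. set hs \<subseteq> walls \<and> word hs = w"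
  using assms
proof (induction rule: weyl_group.induct)
  case id
  show ?case by (intro exI [of _ "[]"]) simp
next
  case (refl \<alpha>)
  have "arefl (\<alpha>, 0) = reflection \<alpha>" by (simp add: arefl_def reflection_def aff_def fun_eq_iff)
  then show ?case using wallsI [OF refl, of 0] by (intro exI [of _ "[(\<alpha>, 0)]"]) simp
next
  case (comp v w)
  then obtain us vs where "set us \<subseteq> walls" "word us = v" "set vs \<subseteq> walls" "word vs = w" by blast
  then show ?case by (intro exI [of _ "us @ vs"]) (simp add: word_append)
qed

text \<open>Conjugation by the translation turns the reflection in \<open>\<alpha>\<close> into that
  in the hyperplane \<open>\<alpha> \<bullet> x = - (\<alpha> \<bullet> u a)\<close>, a wall by
  integrality.\<close>

lemma translated_weyl_word:
  assumes "w \<in> W" "u \<in> W"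
  shows "\<exists>hs. set hs \<subseteq> walls \<and> word hs = (\<lambda>x. w (x + u a) - u a)"
  using assms
proof (induction rule: weyl_group.induct)
  case id
  show ?case by (intro exI [of _ "[]"]) (simp add: fun_eq_iff)
next
  case (refl \<alpha>)
  obtain k where k: "\<alpha> \<bullet> u a = of_int k * bound R a \<alpha>" using inner_weyl_minuscule refl by blast
  have "arefl (\<alpha>, of_int (- k) * bound R a \<alpha>) x = reflection \<alpha> (x + u a) - u a" for x
    by (simp add: arefl_def reflection_def aff_def inner_add_right k)
  then show ?case
    using wallsI [of \<alpha> "- k"] refl
    by (intro exI [of _ "[(\<alpha>, of_int (- k) * bound R a \<alpha>)]"]) (simp add: fun_eq_iff)
next
  case (comp v w)
  then obtain us vs where "set us \<subseteq> walls" "word us = (\<lambda>x. v (x + u a) - u a)"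
    "set vs \<subseteq> walls" "word vs = (\<lambda>x. w (x + u a) - u a)" by blast
  then show ?case by (intro exI [of _ "us @ vs"]) (simp add: word_append fun_eq_iff)
qed

text \<open>Let \<open>u\<close> carry \<open>u1 a\<close> to \<open>u2 a\<close>. The map is
  \<open>u\<close> applied after the conjugate of \<open>inv u \<circ> v\<close> by the translation
  by \<open>u1 a\<close>.\<close>

lemma transporter_word:
  assumes "v \<in> W" "u1 \<in> W" "u2 \<in> W"
  shows "\<exists>hs. set hs \<subseteq> walls \<and> word hs = (\<lambda>x. v (x + u1 a) - u2 a)"
proof -
  define u where "u = (\<lambda>x. u2 (inv u1 x))"
  have u: "u \<in> W" "u (u1 a) = u2 a"
    using assms by (simp_all add: u_def weyl_comp weyl_group_inv weyl_inv)
  have iu: "(\<lambda>x. inv u (v x)) \<in> W" using assms u by (simp add: weyl_comp weyl_group_inv)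
  obtain us vs where "set us \<subseteq> walls" "word us = u"
    "set vs \<subseteq> walls" "word vs = (\<lambda>x. inv u (v (x + u1 a)) - u1 a)"
    using weyl_word [OF u(1)] translated_weyl_word [OF iu assms(2)] by blast
  moreover have "u (inv u y - u1 a) = y - u2 a" for y
    using u by (simp add: linear_diff [OF weyl_linear] weyl_inv)
  ultimately show ?thesis by (intro exI [of _ "us @ vs"]) (simp add: word_append fun_eq_iff)
qed

section \<open>Uniqueness of the dominant position, and conjugacy of pairs\<close>

lemma dominant_unique:
  assumes u: "u1 \<in> W" "u2 \<in> W" and v: "v \<in> W" "v (b + u1 a) = b + u2 a"
    and q: "\<And>\<alpha>. \<alpha> \<in> R \<Longrightarrow> \<alpha> \<bullet> q \<noteq> 0"
    and dom1: "\<And>\<alpha>. \<alpha> \<in> R \<Longrightarrow> \<alpha> \<bullet> b = 0 \<Longrightarrow> 0 \<le> (\<alpha> \<bullet> u1 a) * (\<alpha> \<bullet> q)"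
    and dom2: "\<And>\<alpha>. \<alpha> \<in> R \<Longrightarrow> \<alpha> \<bullet> b = 0 \<Longrightarrow> 0 \<le> (\<alpha> \<bullet> u2 a) * (\<alpha> \<bullet> q)"
  shows "u1 a = u2 a"
proof -
  define y1 y2 where "y1 = b + u1 a" and "y2 = b + u2 a"
  have pos: "\<forall>\<^sub>F t in at_right (0::real). 0 < t" by (simp add: eventually_at_right_less)
  \<comment> \<open>A small step from \<open>b\<close> towards \<open>q\<close>: roots nonzero at
    \<open>b\<close> keep their sign, the others take that of \<open>q\<close>.\<close>
  obtain \<delta> where \<delta>: "\<delta> > 0"
    "\<And>\<alpha>. \<alpha> \<in> R \<Longrightarrow> \<alpha> \<bullet> b \<noteq> 0 \<Longrightarrow> 0 < (\<alpha> \<bullet> b) * (\<alpha> \<bullet> (b + \<delta> *\<^sub>R q))"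
    using eventually_happens' [OF trivial_limit_at_right_real eventually_conj [OF pos
      finite_eventually_same_sign [OF finite_R, of b q]]] by blast
  define p0 where "p0 = b + \<delta> *\<^sub>R q"
  have p0: "\<alpha> \<bullet> p0 \<noteq> 0" if "\<alpha> \<in> R" for \<alpha>
  proof (cases "\<alpha> \<bullet> b = 0")
    case True
    then show ?thesis using \<delta>(1) q [OF that] by (simp add: p0_def inner_add_right)
  next
    case False
    then show ?thesis using \<delta>(2) [OF that False] by (auto simp: p0_def)
  qed
  \<comment> \<open>If \<open>\<alpha>\<close> has a wall through \<open>b\<close>, then
    \<open>\<alpha> \<bullet> b\<close> is zero or at least one spacing in modulus, whereas
    \<open>\<alpha> \<bullet> w a\<close> is at most one spacing. So adding \<open>w a\<close>
    cannot reverse the sign.\<close>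
  have dom: "0 \<le> (\<alpha> \<bullet> (b + w a)) * (\<alpha> \<bullet> p0)"
    if \<alpha>: "\<alpha> \<in> R" and k: "\<alpha> \<bullet> b = of_int k * bound R a \<alpha>" and w: "w \<in> W"
      and d: "\<alpha> \<bullet> b = 0 \<Longrightarrow> 0 \<le> (\<alpha> \<bullet> w a) * (\<alpha> \<bullet> q)" for \<alpha> k w
  proof (cases "\<alpha> \<bullet> b = 0")
    case True
    then have "(\<alpha> \<bullet> (b + w a)) * (\<alpha> \<bullet> p0) = \<delta> * ((\<alpha> \<bullet> w a) * (\<alpha> \<bullet> q))"
      by (simp add: p0_def inner_add_right)
    then show ?thesis using d True \<delta> by simp
  next
    case False
    then have "k \<noteq> 0" using k by auto
    then have "1 \<le> \<bar>real_of_int k\<bar>" by linarith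
    then have "bound R a \<alpha> \<le> \<bar>\<alpha> \<bullet> b\<bar>"
      using bound_nonneg [OF \<alpha>] mult_right_mono [of 1 "\<bar>real_of_int k\<bar>" "bound R a \<alpha>"]
      by (simp add: k abs_mult)
    then have "\<bar>\<alpha> \<bullet> w a\<bar> \<le> \<bar>\<alpha> \<bullet> b\<bar>" using inner_weyl_minuscule(2) [OF \<alpha> w] by linarith
    moreover have "0 < (\<alpha> \<bullet> b) * (\<alpha> \<bullet> p0)" using \<delta>(2) [OF \<alpha> False] by (simp add: p0_def)
    ultimately show ?thesis unfolding inner_add_right by (rule abs_le_same_sign)
  qed
  \<comment> \<open>This correction of \<open>v\<close> serves the roots vanishing at
    \<open>y2\<close>: their sign at \<open>z2\<close> below is that of their value at
    \<open>k (v p0)\<close>.\<close>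
  obtain k where k: "k \<in> W" "k y2 = y2"
    and kdom: "\<And>\<alpha>. \<alpha> \<in> R \<Longrightarrow> \<alpha> \<bullet> y2 = 0 \<Longrightarrow> 0 \<le> (\<alpha> \<bullet> k (v p0)) * (\<alpha> \<bullet> p0)"
    using exists_dominant_conjugate [of y2 "v p0" p0] by blast
  define v' where "v' = (\<lambda>x. k (v x))"
  have v': "v' \<in> W" "v' y1 = y2" using k v by (simp_all add: v'_def weyl_comp y1_def y2_def)
  obtain \<eta> where \<eta>: "\<eta> > 0"
    "\<And>\<alpha>. \<alpha> \<in> R \<Longrightarrow> \<alpha> \<bullet> y1 \<noteq> 0 \<Longrightarrow> 0 < (\<alpha> \<bullet> y1) * (\<alpha> \<bullet> (y1 + \<eta> *\<^sub>R p0))"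
    "\<And>\<alpha>. \<alpha> \<in> R \<Longrightarrow> \<alpha> \<bullet> y2 \<noteq> 0 \<Longrightarrow> 0 < (\<alpha> \<bullet> y2) * (\<alpha> \<bullet> (y2 + \<eta> *\<^sub>R v' p0))"
    using eventually_happens' [OF trivial_limit_at_right_real eventually_conj [OF pos
      eventually_conj [OF finite_eventually_same_sign [OF finite_R, of y1 p0]
        finite_eventually_same_sign [OF finite_R, of y2 "v' p0"]]]] by blast
  \<comment> \<open>By linearity \<open>z2 = v' z1\<close>. The small \<open>\<eta>\<close> lets the
    added term decide the sign only for roots vanishing at \<open>y1\<close> or \<open>y2\<close>
    respectively.\<close>
  define z1 z2 where "z1 = y1 + \<eta> *\<^sub>R p0" and "z2 = y2 + \<eta> *\<^sub>R v' p0"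
  have z: "0 < (\<alpha> \<bullet> z1) * (\<alpha> \<bullet> p0)" "0 \<le> (\<alpha> \<bullet> z2) * (\<alpha> \<bullet> p0)"
    if \<alpha>: "\<alpha> \<in> R" and m: "\<alpha> \<bullet> b = of_int m * bound R a \<alpha>" for \<alpha> m
  proof -
    have d1: "0 \<le> (\<alpha> \<bullet> y1) * (\<alpha> \<bullet> p0)" and d2: "0 \<le> (\<alpha> \<bullet> y2) * (\<alpha> \<bullet> p0)"
      unfolding y1_def y2_def using dom [OF \<alpha> m] u dom1 dom2 \<alpha> by blast+
    show "0 < (\<alpha> \<bullet> z1) * (\<alpha> \<bullet> p0)"
    proof (cases "\<alpha> \<bullet> y1 = 0")
      case True
      then have "(\<alpha> \<bullet> z1) * (\<alpha> \<bullet> p0) = \<eta> * ((\<alpha> \<bullet> p0) * (\<alpha> \<bullet> p0))"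
        by (simp add: z1_def inner_add_right)
      moreover have "0 < (\<alpha> \<bullet> p0) * (\<alpha> \<bullet> p0)" using p0 [OF \<alpha>] not_real_square_gt_zero by blast
      ultimately show ?thesis using \<eta>(1) mult_pos_pos by metis
    next
      case False
      then have "0 < (\<alpha> \<bullet> y1) * (\<alpha> \<bullet> p0)" using d1 p0 [OF \<alpha>] by (simp add: order_less_le)
      then show ?thesis using \<eta>(2) [OF \<alpha> False] same_sign_trans(1) unfolding z1_def by blast
    qed
    show "0 \<le> (\<alpha> \<bullet> z2) * (\<alpha> \<bullet> p0)"
    proof (cases "\<alpha> \<bullet> y2 = 0")
      case True
      then have "(\<alpha> \<bullet> z2) * (\<alpha> \<bullet> p0) = \<eta> * ((\<alpha> \<bullet> v' p0) * (\<alpha> \<bullet> p0))"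
        by (simp add: z2_def inner_add_right)
      moreover have "0 \<le> (\<alpha> \<bullet> v' p0) * (\<alpha> \<bullet> p0)" using kdom [OF \<alpha> True] by (simp add: v'_def)
      ultimately show ?thesis using \<eta>(1) by (metis mult_nonneg_nonneg order_less_imp_le)
    next
      case False
      then show ?thesis using \<eta>(3) [OF \<alpha> False] d2 same_sign_trans(2) unfolding z2_def by blast
    qed
  qed
  obtain \<mu> where \<mu>: "\<mu> > 0" "\<And>h. h \<in> walls \<Longrightarrow> aff h b \<noteq> 0 \<Longrightarrow> \<mu> \<le> \<bar>aff h b\<bar>"
    using walls_gap [of b] by blast
  have small: "\<forall>\<^sub>F t in at_right 0. \<forall>\<alpha>\<in>R. \<bar>\<alpha> \<bullet> (t *\<^sub>R y)\<bar> < \<mu>" for y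
  proof (intro eventually_ball_finite finite_R ballI)
    fix \<alpha> assume "\<alpha> \<in> R"
    have "((\<lambda>t. \<bar>\<alpha> \<bullet> (t *\<^sub>R y)\<bar>) \<longlongrightarrow> \<bar>\<alpha> \<bullet> (0 *\<^sub>R y)\<bar>) (at_right 0)"
      by (intro tendsto_intros)
    then show "\<forall>\<^sub>F t in at_right 0. \<bar>\<alpha> \<bullet> (t *\<^sub>R y)\<bar> < \<mu>"
      using \<mu> by (intro order_tendstoD(2)) auto
  qed
  obtain \<epsilon> where \<epsilon>: "\<epsilon> > 0" "\<And>\<alpha>. \<alpha> \<in> R \<Longrightarrow> \<bar>\<alpha> \<bullet> (\<epsilon> *\<^sub>R z1)\<bar> < \<mu>"
    "\<And>\<alpha>. \<alpha> \<in> R \<Longrightarrow> \<bar>\<alpha> \<bullet> (\<epsilon> *\<^sub>R z2)\<bar> < \<mu>"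
    using eventually_happens' [OF trivial_limit_at_right_real eventually_conj [OF pos
      eventually_conj [OF small [of z1] small [of z2]]]] by blast
  \<comment> \<open>The affine map of the outline, with \<open>v'\<close> for \<open>v\<close>,
    sends \<open>p\<close> to \<open>b + \<epsilon> *\<^sub>R z2\<close>. Walls missing
    \<open>b\<close> are too far away to be crossed; for walls through \<open>b\<close> the signs at
    \<open>z1\<close> and \<open>z2\<close> decide.\<close>
  define p where "p = b + \<epsilon> *\<^sub>R z1"
  have affs: "aff h (b + x) = aff h b + fst h \<bullet> x" for h :: "'a \<times> real" and x
    by (simp add: aff_def inner_add_right)
  have sides: "aff h p \<noteq> 0 \<and> 0 \<le> aff h p * aff h (b + \<epsilon> *\<^sub>R z2)" if h: "h \<in> walls" for h
  proof -
    obtain \<alpha> m where \<alpha>: "\<alpha> \<in> R" "h = (\<alpha>, of_int m * bound R a \<alpha>)" using h by (auto simp: walls_def)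
    show ?thesis
    proof (cases "aff h b = 0")
      case True
      then have "\<alpha> \<bullet> b = of_int m * bound R a \<alpha>" by (simp add: aff_def \<alpha>)
      note zz = z [OF \<alpha>(1) this]
      have "\<alpha> \<bullet> z1 \<noteq> 0" "0 \<le> (\<alpha> \<bullet> z1) * (\<alpha> \<bullet> z2)"
        using zz same_sign_trans(2) [of "\<alpha> \<bullet> p0" "\<alpha> \<bullet> z1" "\<alpha> \<bullet> z2"] by (auto simp: mult.commute)
      moreover have "aff h p = \<epsilon> * (\<alpha> \<bullet> z1)" "aff h (b + \<epsilon> *\<^sub>R z2) = \<epsilon> * (\<alpha> \<bullet> z2)"
        unfolding p_def affs True by (simp_all add: \<alpha>)
      moreover from this have "aff h p * aff h (b + \<epsilon> *\<^sub>R z2) = \<epsilon> * \<epsilon> * ((\<alpha> \<bullet> z1) * (\<alpha> \<bullet> z2))"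
        by simp
      ultimately show ?thesis using \<epsilon>(1)
        by (metis mult_eq_0_iff mult_nonneg_nonneg order_less_imp_le less_irrefl)
    next
      case False
      then have "\<bar>\<alpha> \<bullet> (\<epsilon> *\<^sub>R z1)\<bar> < \<bar>aff h b\<bar>" "\<bar>\<alpha> \<bullet> (\<epsilon> *\<^sub>R z2)\<bar> < \<bar>aff h b\<bar>"
        using \<mu>(2) [OF h False] \<epsilon>(2,3) [OF \<alpha>(1)] by linarith+
      then have "aff h b + \<alpha> \<bullet> (\<epsilon> *\<^sub>R z1) \<noteq> 0 \<and>
        0 \<le> (aff h b + \<alpha> \<bullet> (\<epsilon> *\<^sub>R z1)) * (aff h b + \<alpha> \<bullet> (\<epsilon> *\<^sub>R z2))"
        by (rule abs_less_same_sign)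
      then show ?thesis unfolding p_def affs by (simp add: \<alpha>(2))
    qed
  qed
  interpret reflection_arrangement walls p
  proof
    show "fst h \<noteq> 0" if "h \<in> walls" for h using that zero_notin_R by (auto simp: walls_def)
  qed (use walls_pullback sides walls_locally_finite in auto)
  obtain hs where hs: "set hs \<subseteq> walls" "word hs = (\<lambda>x. v' (x + u1 a) - u2 a)"
    using transporter_word [OF v'(1) u] by blast
  have "p + u1 a = y1 + \<epsilon> *\<^sub>R z1" by (simp add: p_def y1_def)
  then have "v' (p + u1 a) = y2 + \<epsilon> *\<^sub>R z2"
    using v' weyl_linear [OF v'(1)] by (simp add: linear_add linear_scale z1_def z2_def)
  then have "word hs p = b + \<epsilon> *\<^sub>R z2" by (simp add: hs y2_def)
  then have "word hs = id" using not_separated_imp_id [OF hs(1)] sides by simp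
  then have id: "v' (x + u1 a) - u2 a = x" for x by (metis hs(2) id_apply)
  have "v' (u1 a) = u2 a" using id [of 0] by simp
  moreover have "v' 0 = 0" by (rule linear_0 [OF weyl_linear [OF v'(1)]])
  \<comment> \<open>At \<open>x = - u1 a\<close> the identity reads
    \<open>v' 0 - u2 a = - u1 a\<close>.\<close>
  ultimately show ?thesis using id [of "- u1 a"] by simp
qed

text \<open>Elements \<open>h1\<close> and \<open>h2\<close> fixing \<open>b\<close> make
  \<open>u1 a\<close> and \<open>u2 a\<close> dominant. Uniqueness identifies the results, and
  \<open>inv h2 \<circ> h1\<close> conjugates.\<close>

lemma conjugate_pairs:
  assumes u: "u1 \<in> W" "u2 \<in> W" and v: "v \<in> W" "v (b + u1 a) = b + u2 a"
  shows "\<exists>h\<in>W. h b = b \<and> h (u1 a) = u2 a"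
proof -
  obtain q where q: "\<And>\<alpha>. \<alpha> \<in> R \<Longrightarrow> \<alpha> \<bullet> q \<noteq> 0"
    using finite_avoid_hyperplanes [OF finite_R zero_notin_R] by blast
  obtain h1 where h1: "h1 \<in> W" "h1 b = b"
    "\<And>\<alpha>. \<alpha> \<in> R \<Longrightarrow> \<alpha> \<bullet> b = 0 \<Longrightarrow> 0 \<le> (\<alpha> \<bullet> h1 (u1 a)) * (\<alpha> \<bullet> q)"
    using exists_dominant_conjugate [of b "u1 a" q] by blast
  obtain h2 where h2: "h2 \<in> W" "h2 b = b"
    "\<And>\<alpha>. \<alpha> \<in> R \<Longrightarrow> \<alpha> \<bullet> b = 0 \<Longrightarrow> 0 \<le> (\<alpha> \<bullet> h2 (u2 a)) * (\<alpha> \<bullet> q)"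
    using exists_dominant_conjugate [of b "u2 a" q] by blast
  have inv_b: "inv h1 b = b" "inv h2 b = b"
    using weyl_inv(1) [OF h1(1), of b] weyl_inv(1) [OF h2(1), of b] h1 h2 by simp_all
  have "h2 (v (inv h1 (b + h1 (u1 a)))) = b + h2 (u2 a)"
    using v h1 h2 inv_b
    by (simp add: linear_add [OF weyl_linear [OF weyl_group_inv]]
      linear_add [OF weyl_linear [OF h2(1)]] weyl_inv)
  then have "h1 (u1 a) = h2 (u2 a)"
    using dominant_unique [of "\<lambda>x. h1 (u1 x)" "\<lambda>x. h2 (u2 x)" "\<lambda>x. h2 (v (inv h1 x))" b q]
    using u v h1 h2 q weyl_comp [OF h2(1) weyl_comp [OF v(1) weyl_group_inv [OF h1(1)]]]
    by (simp add: weyl_comp)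
  then have "inv h2 (h1 (u1 a)) = u2 a" using weyl_inv(1) [OF h2(1)] by simp
  then show ?thesis using h1 h2 inv_b
    by (intro bexI [of _ "\<lambda>x. inv h2 (h1 x)"]) (simp_all add: weyl_comp weyl_group_inv)
qed

end

theorem proposition1:
  fixes R :: "'a::euclidean_space set" and a :: 'a
  assumes "reduced_root_system R"
    and "minuscule R a"
  shows "\<forall>b b'.
    conjugate_under (weyl_group R) b b' \<and> conjugate_under (weyl_group R) (a + b) (a + b')
      \<longrightarrow> conjugate_under (stabilizer (weyl_group R) a) b b'"
proof (intro allI impI, elim conjE)
  fix b b'
  assume "conjugate_under (weyl_group R) b b'" "conjugate_under (weyl_group R) (a + b) (a + b')"
  then obtain w u where w: "w \<in> weyl_group R" "b' = w b"
    and u: "u \<in> weyl_group R" "a + b' = u (a + b)"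
    by (auto simp: conjugate_under_def)
  interpret minuscule_root_system R a
    using assms by unfold_locales (auto simp: reduced_root_system_def)
  \<comment> \<open>Applying \<open>inv w\<close> exchanges the roles: \<open>b\<close> becomes the
    common summand, and \<open>a\<close> and \<open>inv w a\<close> the pair to be
    conjugated.\<close>
  have "inv w (u (b + id a)) = inv w (a + w b)" using u w by (simp add: add.commute)
  also have "\<dots> = b + inv w a"
    using w by (simp add: linear_add [OF weyl_linear [OF weyl_group_inv]] weyl_inv)
  finally obtain h where h: "h \<in> weyl_group R" "h b = b" "h (id a) = inv w a"
    using conjugate_pairs [of id "inv w" "\<lambda>x. inv w (u x)" b] u w
    by (auto simp: weyl_comp weyl_group_inv weyl_group.id)
  \<comment> \<open>The composite takes \<open>a\<close> to \<open>inv w a\<close> and back to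
    \<open>a\<close>, while \<open>h\<close> fixes \<open>b\<close> and \<open>w\<close> sends it to
    \<open>b'\<close>.\<close>
  then have "(\<lambda>x. w (h x)) \<in> stabilizer (weyl_group R) a" "b' = w (h b)"
    using w by (simp_all add: stabilizer_def weyl_comp weyl_inv)
  then show "conjugate_under (stabilizer (weyl_group R) a) b b'"
    unfolding conjugate_under_def using h by (intro bexI [of _ "\<lambda>x. w (h x)"]) simp_all
qed

end
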